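(* Let $X\subseteq\mathbb{R}^d$ be a nonempty closed convex set, let $h:\mathbb{R}^d\to\mathbb{R}$ be continuously differentiable and $1$-strongly convex with respect to $\|\cdot\|_1$, and let $f:\mathbb{R}^d\to\mathbb{R}$ be a smooth function that is $\rho$-relatively weakly convex, i.e. $f+\rho h$ is convex, for some $\rho>0$. Let $\lambda\in(0,\rho^{-1})$. Then for every $\mathbf{x}\in X$, $$r(\mathbf{x})\ge(1-\lambda\rho)\,r_2(\mathbf{x}).$$
   Context: The Bregman divergence of $h$ is $D_h(\mathbf{u},\mathbf{v})=h(\mathbf{u})-h(\mathbf{v})-\langle\nabla h(\mathbf{v}),\mathbf{u}-\mathbf{v}\rangle$; $1$-strong convexity w.r.t. $\|\cdot\|_1$ means $D_h(\mathbf{u},\mathbf{v})\ge\frac12\|\mathbf{u}-\mathbf{v}\|_1^2$ for all $\mathbf{u},\mathbf{v}$. Define $$\mathrm{prox}_{\lambda f}(\mathbf{x})=\arg\min_{\mathbf{z}\in X}\Big\{f(\mathbf{z})+\frac1\lambda D_h(\mathbf{z},\mathbf{x})\Big\},$$ $$r_2(\mathbf{x})=\frac1\lambda\sqrt{D_h(\mathbf{x},\mathrm{prox}_{\lambda f}(\mathbf{x}))+D_h(\mathrm{prox}_{\lambda f}(\mathbf{x}),\mathbf{x})},$$ $$r(\mathbf{x})=\inf\{\|\mathbf{v}\|_\infty:\mathbf{v}\in\partial(f+\delta_X)(\mathbf{x})\},$$ where $\delta_X$ is the indicator function of $X$ and $\partial(f+\delta_X)(\mathbf{x})=\nabla f(\mathbf{x})+N_X(\mathbf{x})$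 for $\mathbf{x}\in X$, with $N_X(\mathbf{x})$ the normal cone of $X$ at $\mathbf{x}$. *)

theory Defs
  imports "HOL-Analysis.Analysis"
begin

definition grad :: "('a::real_inner \<Rightarrow> real) \<Rightarrow> 'a \<Rightarrow> 'a" where
  "grad f x = (THE g. GDERIV f x :> g)"

lemma GDERIV_grad:
  fixes f :: "'a::euclidean_space \<Rightarrow> real"
  assumes "f differentiable (at x)"
  shows "GDERIV f x :> grad f x"
proof -
  obtain f' where f': "(f has_derivative f') (at x)"
    using assms by (auto simp: differentiable_def)
  have lin: "linear f'"
    using f' by (rule has_derivative_linear)
  have "f' = (\<lambda>u. u \<bullet> adjoint f' 1)"
    using adjoint_works[OF lin, of _ 1] by (auto simp: fun_eq_iff)
  with f' have g: "GDERIV f x :> adjoint f' 1"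
    by (simp add: gderiv_def)
  have "g' = adjoint f' 1" if "GDERIV f x :> g'" for g'
  proof -
    have "(\<lambda>u. u \<bullet> g') = (\<lambda>u. u \<bullet> adjoint f' 1)"
      using that g unfolding gderiv_def by (rule has_derivative_unique)
    then show ?thesis
      by (metis vector_eq_ldot)
  qed
  with g show ?thesis
    unfolding grad_def by (rule theI)
qed

definition continuously_differentiable :: "('a::real_inner \<Rightarrow> real) \<Rightarrow> bool" where
  "continuously_differentiable f \<longleftrightarrow>
     (\<forall>x. f differentiable (at x)) \<and> continuous_on UNIV (grad f)"

definition l1norm :: "real ^ 'd \<Rightarrow> real" where
  "l1norm x = (\<Sum>i\<in>UNIV. \<bar>x $ i\<bar>)"

definition bregman :: "('a::real_inner \<Rightarrow> real) \<Rightarrow> 'a \<Rightarrow> 'a \<Rightarrow> real" where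
  "bregman h u v = h u - h v - grad h v \<bullet> (u - v)"

definition strongly_convex_l1 :: "(real ^ 'd \<Rightarrow> real) \<Rightarrow> bool" where
  "strongly_convex_l1 h \<longleftrightarrow> (\<forall>u v. bregman h u v \<ge> 1 / 2 * (l1norm (u - v))\<^sup>2)"

definition relatively_weakly_convex ::
    "real \<Rightarrow> ('a::real_vector \<Rightarrow> real) \<Rightarrow> ('a \<Rightarrow> real) \<Rightarrow> bool" where
  "relatively_weakly_convex \<rho> h f \<longleftrightarrow> convex_on UNIV (\<lambda>x. f x + \<rho> * h x)"

text \<open>The library's \<open>arg_min_on\<close> picks some minimizer over the set, provided one exists.
  For nonempty closed convex \<open>X\<close>, \<open>h\<close> strongly convex, \<open>f + \<rho> h\<close> convex and
  \<open>0 < lam < 1/\<rho>\<close>, the objective is continuous and strongly convex, so that the minimizer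
  exists and is unique.\<close>

definition bregman_prox ::
    "'a::real_inner set \<Rightarrow> ('a \<Rightarrow> real) \<Rightarrow> real \<Rightarrow> ('a \<Rightarrow> real) \<Rightarrow> 'a \<Rightarrow> 'a" where
  "bregman_prox X h lam f x = arg_min_on (\<lambda>z. f z + 1 / lam * bregman h z x) X"

definition r2 ::
    "'a::real_inner set \<Rightarrow> ('a \<Rightarrow> real) \<Rightarrow> real \<Rightarrow> ('a \<Rightarrow> real) \<Rightarrow> 'a \<Rightarrow> real" where
  "r2 X h lam f x =
     1 / lam * sqrt (bregman h x (bregman_prox X h lam f x) + bregman h (bregman_prox X h lam f x) x)"

definition normal_cone :: "'a::real_inner set \<Rightarrow> 'a \<Rightarrow> 'a set" where
  "normal_cone X x = {n. x \<in> X \<and> (\<forall>y\<in>X. n \<bullet> (y - x) \<le> 0)}"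

text \<open>The subdifferential of \<open>f + \<delta>\<^sub>X\<close> for differentiable \<open>f\<close> and closed convex \<open>X\<close>, given by
  \<open>\<nabla>f(x) + N\<^sub>X(x)\<close>. It is empty outside \<open>X\<close>, and contains \<open>\<nabla>f(x)\<close> for \<open>x \<in> X\<close>.\<close>

definition subdiff_constrained :: "('a::real_inner \<Rightarrow> real) \<Rightarrow> 'a set \<Rightarrow> 'a \<Rightarrow> 'a set" where
  "subdiff_constrained f X x = {grad f x + n | n. n \<in> normal_cone X x}"

text \<open>The infimum is over a set bounded below by \<open>0\<close>, nonempty for \<open>x \<in> X\<close>; the library's
  \<open>infnorm\<close> is the maximum norm.\<close>

definition r_stat :: "(real ^ 'd \<Rightarrow> real) \<Rightarrow> (real ^ 'd) set \<Rightarrow> real ^ 'd \<Rightarrow> real" where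
  "r_stat f X x = Inf {infnorm v | v. v \<in> subdiff_constrained f X x}"

end

theory Submission
  imports Defs
begin

text \<open>
  Let \<open>z\<close> be the proximal point of \<open>x\<close> and \<open>S = D\<^sub>h(x,z) + D\<^sub>h(z,x)\<close>. This symmetrized
  divergence equals \<open>\<langle>\<nabla>h(x) - \<nabla>h(z), x - z\<rangle>\<close>, and strong convexity gives
  \<open>S \<ge> \<parallel>x - z\<parallel>\<^sub>1\<^sup>2\<close>. Let \<open>v = \<nabla>f(x) + n\<close> be a subgradient, with \<open>n\<close> normal to \<open>X\<close> at \<open>x\<close>.
  The pairing \<open>\<langle>v, x - z\<rangle>\<close> is estimated from both sides.

  From below, three variational inequalities are added. Normality gives
  \<open>\<langle>n, x - z\<rangle> \<ge> 0\<close>. The gradient of the convex function \<open>f + \<rho> h\<close> is monotone, so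
  \<open>\<langle>\<nabla>f(x) - \<nabla>f(z), x - z\<rangle> \<ge> - \<rho> S\<close>. Optimality of \<open>z\<close> in the direction of \<open>x \<in> X\<close> gives
  \<open>\<langle>\<nabla>f(z), x - z\<rangle> \<ge> S / \<lambda>\<close>. Together \<open>\<langle>v, x - z\<rangle> \<ge> (1 - \<lambda>\<rho>) S / \<lambda>\<close>.

  From above, the duality of the maximum norm and the \<open>\<ell>\<^sub>1\<close> norm gives
  \<open>\<langle>v, x - z\<rangle> \<le> \<parallel>v\<parallel>\<^sub>\<infinity> \<parallel>x - z\<parallel>\<^sub>1 \<le> \<parallel>v\<parallel>\<^sub>\<infinity> \<surd>S\<close>. Dividing by \<open>\<surd>S\<close> bounds \<open>\<parallel>v\<parallel>\<^sub>\<infinity>\<close> below by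
  \<open>(1 - \<lambda>\<rho>) \<surd>S / \<lambda>\<close>.

  The argument needs that the proximal point exists. By convexity of \<open>f + \<rho> h\<close> the proximal
  objective lies above a function that is affine plus \<open>(1/\<lambda> - \<rho>) D\<^sub>h(\<cdot>, x)\<close>, and the latter
  grows quadratically (\<open>prox_objective_ge\<close>). Minimizing over \<open>X\<close> thus reduces to minimizing
  over a compact part of \<open>X\<close> (\<open>bregman_prox_minimizes\<close>).
\<close>

lemma l1norm_nonneg: "0 \<le> l1norm x"
  by (simp add: l1norm_def sum_nonneg)

lemma norm_le_l1norm: "norm x \<le> l1norm x"
  unfolding l1norm_def by (rule norm_le_l1_cart)

lemma l1norm_minus_commute: "l1norm (x - y) = l1norm (y - x)"
  by (simp add: l1norm_def abs_minus_commute)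

lemma inner_le_infnorm_l1norm: "v \<bullet> w \<le> infnorm v * l1norm w"
proof -
  have "v $ i * w $ i \<le> infnorm v * \<bar>w $ i\<bar>" for i
  proof -
    have "v $ i * w $ i \<le> \<bar>v $ i\<bar> * \<bar>w $ i\<bar>"
      by (metis abs_ge_self abs_mult)
    also have "\<dots> \<le> infnorm v * \<bar>w $ i\<bar>"
      by (intro mult_right_mono component_le_infnorm_cart) simp
    finally show ?thesis .
  qed
  then show ?thesis
    by (simp add: inner_vec_def l1norm_def sum_distrib_left sum_mono)
qed

lemma bregman_self [simp]: "bregman h x x = 0"
  by (simp add: bregman_def)

lemma bregman_symmetrized:
  "bregman h x z + bregman h z x = (grad h x - grad h z) \<bullet> (x - z)"
  by (simp add: bregman_def inner_diff_left inner_diff_right)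

lemma l1norm_square_le_bregman_symmetrized:
  assumes "strongly_convex_l1 h"
  shows "(l1norm (x - z))\<^sup>2 \<le> bregman h x z + bregman h z x"
proof -
  have "1 / 2 * (l1norm (x - z))\<^sup>2 \<le> bregman h x z"
    and "1 / 2 * (l1norm (z - x))\<^sup>2 \<le> bregman h z x"
    using assms by (simp_all add: strongly_convex_l1_def)
  then show ?thesis
    by (simp add: l1norm_minus_commute[of z x])
qed

text \<open>A linear minorant of \<open>F\<close> along a segment passes to the limit in the difference quotient.
  This yields both the first-order optimality condition (with \<open>c = 0\<close>) and the tangent
  inequality for convex functions.\<close>

lemma gradient_inner_ge:
  fixes F :: "'a::real_inner \<Rightarrow> real"
  assumes F: "GDERIV F a :> g"
    and minorant: "\<And>t. 0 < t \<Longrightarrow> t < 1 \<Longrightarrow> F a + t * c \<le> F (a + t *\<^sub>R d)"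
  shows "c \<le> g \<bullet> d"
proof -
  have "((\<lambda>t. a + t *\<^sub>R d) has_derivative (\<lambda>t. t *\<^sub>R d)) (at 0)"
    by (auto intro!: derivative_eq_intros)
  moreover have "(F has_derivative (\<lambda>u. u \<bullet> g)) (at (a + 0 *\<^sub>R d))"
    using F by (simp add: gderiv_def)
  ultimately have "((\<lambda>t. F (a + t *\<^sub>R d)) has_derivative (\<lambda>t. (t *\<^sub>R d) \<bullet> g)) (at 0)"
    by (rule has_derivative_compose)
  then have "((\<lambda>t. F (a + t *\<^sub>R d)) has_real_derivative (g \<bullet> d)) (at 0)"
    unfolding has_field_derivative_def
    by (rule has_derivative_eq_rhs) (simp add: fun_eq_iff inner_commute)
  then have "((\<lambda>t. (F (a + t *\<^sub>R d) - F a) / t) \<longlongrightarrow> g \<bullet> d) (at_right 0)"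
    by (auto simp: DERIV_def intro: tendsto_within_subset)
  moreover have "\<forall>\<^sub>F t in at_right 0. c \<le> (F (a + t *\<^sub>R d) - F a) / t"
    unfolding eventually_at_right_field
    using minorant by (intro exI[of _ 1]) (auto simp: field_simps)
  ultimately show ?thesis
    by (intro tendsto_lowerbound) auto
qed

lemma convex_on_ge_tangent:
  fixes F :: "'a::real_inner \<Rightarrow> real"
  assumes convex: "convex_on UNIV F" and F: "GDERIV F a :> g"
  shows "F a + g \<bullet> (b - a) \<le> F b"
proof -
  have "F a - F b \<le> (- g) \<bullet> (b - a)"
  proof (rule gradient_inner_ge[where F = "\<lambda>x. - F x" and a = a])
    show "GDERIV (\<lambda>x. - F x) a :> - g"
      using F by (rule GDERIV_minus)
    fix t :: real assume t: "0 < t" "t < 1"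
    have "F ((1 - t) *\<^sub>R a + t *\<^sub>R b) \<le> (1 - t) * F a + t * F b"
      using t by (intro convex_onD[OF convex]) auto
    then show "- F a + t * (F a - F b) \<le> - F (a + t *\<^sub>R (b - a))"
      by (simp add: algebra_simps)
  qed
  then show ?thesis
    by (simp add: inner_minus_left)
qed

lemma convex_on_gradient_monotone:
  fixes F :: "'a::real_inner \<Rightarrow> real"
  assumes "convex_on UNIV F" and "GDERIV F a :> g" and "GDERIV F b :> k"
  shows "0 \<le> (g - k) \<bullet> (a - b)"
  using convex_on_ge_tangent[OF assms(1,2), of b] convex_on_ge_tangent[OF assms(1,3), of a]
  by (simp add: inner_diff_left inner_diff_right)

lemma minimizer_gradient_inner_nonneg:
  fixes F :: "'a::real_inner \<Rightarrow> real"
  assumes "convex X" and "z \<in> X" and "x \<in> X"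
    and minimal: "\<And>w. w \<in> X \<Longrightarrow> F z \<le> F w"
    and F: "GDERIV F z :> g"
  shows "0 \<le> g \<bullet> (x - z)"
proof (rule gradient_inner_ge[OF F])
  fix t :: real assume t: "0 < t" "t < 1"
  have "(1 - t) *\<^sub>R z + t *\<^sub>R x \<in> X"
    using assms(1-3) t by (intro convexD) auto
  then show "F z + t * 0 \<le> F (z + t *\<^sub>R (x - z))"
    using minimal by (simp add: algebra_simps)
qed

lemma GDERIV_weakly_convex_sum:
  assumes "GDERIV f a :> g" and "GDERIV h a :> k"
  shows "GDERIV (\<lambda>w. f w + \<rho> * h w) a :> g + \<rho> *\<^sub>R k"
  using assms unfolding gderiv_def
  by (auto intro!: derivative_eq_intros simp: inner_add_right)

lemma GDERIV_prox_objective: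
  assumes "GDERIV f a :> g" and "GDERIV h a :> k"
  shows "GDERIV (\<lambda>w. f w + c * bregman h w x) a :> g + c *\<^sub>R (k - grad h x)"
  using assms unfolding gderiv_def bregman_def
  by (auto intro!: derivative_eq_intros
      simp: inner_add_right inner_diff_right inner_commute algebra_simps)

text \<open>Writing \<open>f = (f + \<rho> h) - \<rho> h\<close>, the first part lies above its tangent and the second
  part deviates from its tangent by exactly \<open>\<rho> D\<^sub>h\<close>. So the weak convexity of \<open>f\<close> uses up only
  \<open>\<rho>\<close> of the \<open>1/\<lambda>\<close> units of curvature.\<close>

lemma prox_objective_ge:
  assumes weak: "relatively_weakly_convex \<rho> h f"
    and f: "GDERIV f x :> g" and h: "GDERIV h x :> grad h x"
  shows "f x + g \<bullet> (w - x) + (1 / lam - \<rho>) * bregman h w x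
    \<le> f w + 1 / lam * bregman h w x"
proof -
  have "f x + \<rho> * h x + (g + \<rho> *\<^sub>R grad h x) \<bullet> (w - x) \<le> f w + \<rho> * h w"
    using weak GDERIV_weakly_convex_sum[OF f h] unfolding relatively_weakly_convex_def
    by (rule convex_on_ge_tangent)
  then show ?thesis
    by (simp add: bregman_def inner_add_left algebra_simps)
qed

lemma bregman_prox_minimizes:
  fixes X :: "(real ^ 'd) set"
  assumes "closed X" and "x \<in> X"
    and f: "\<And>w. f differentiable (at w)" and h: "\<And>w. h differentiable (at w)"
    and strong: "strongly_convex_l1 h"
    and weak: "relatively_weakly_convex \<rho> h f"
    and curvature: "\<rho> < 1 / lam"
  defines "z \<equiv> bregman_prox X h lam f x"
  shows "z \<in> X"
    and "\<And>w. w \<in> X \<Longrightarrow>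
      f z + 1 / lam * bregman h z x \<le> f w + 1 / lam * bregman h w x"
proof -
  define \<phi> where "\<phi> = (\<lambda>w. f w + 1 / lam * bregman h w x)"
  define c where "c = 1 / lam - \<rho>"
  \<comment> \<open>Beyond this distance from \<open>x\<close> the quadratic term \<open>c/2 \<parallel>w - x\<parallel>\<^sup>2\<close> outweighs the slope
    \<open>\<parallel>\<nabla>f(x)\<parallel>\<close>, so that \<open>\<phi>\<close> exceeds \<open>\<phi> x\<close>.\<close>
  define R where "R = 2 * norm (grad f x) / c"
  have "0 < c"
    using curvature by (simp add: c_def)
  then have "0 \<le> R"
    by (simp add: R_def)
  have far: "\<phi> x \<le> \<phi> w" if "R < dist x w" for w
  proof -
    have "(norm (w - x))\<^sup>2 \<le> (l1norm (w - x))\<^sup>2"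
      by (intro power_mono norm_le_l1norm) simp
    also have "\<dots> \<le> 2 * bregman h w x"
      using strong[unfolded strongly_convex_l1_def, rule_format, of w x] by simp
    finally have growth: "c * (norm (w - x))\<^sup>2 \<le> c * (2 * bregman h w x)"
      using \<open>0 < c\<close> by simp
    have "2 * norm (grad f x) \<le> c * norm (w - x)"
      using that \<open>0 < c\<close> by (simp add: R_def dist_norm norm_minus_commute field_simps)
    then have "2 * norm (grad f x) * norm (w - x) \<le> c * norm (w - x) * norm (w - x)"
      by (rule mult_right_mono) simp
    moreover have "- (norm (grad f x) * norm (w - x)) \<le> grad f x \<bullet> (w - x)"
      using Cauchy_Schwarz_ineq2[of "grad f x" "w - x"] by linarith
    ultimately have "0 \<le> grad f x \<bullet> (w - x) + c * bregman h w x"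
      using growth by (simp add: power2_eq_square)
    moreover have "f x + grad f x \<bullet> (w - x) + c * bregman h w x \<le> \<phi> w"
      unfolding \<phi>_def c_def
      using weak GDERIV_grad[OF f] GDERIV_grad[OF h] by (rule prox_objective_ge)
    ultimately show ?thesis
      by (simp add: \<phi>_def)
  qed
  have "continuous_on UNIV f" "continuous_on UNIV h"
    using f h by (auto intro!: continuous_at_imp_continuous_on differentiable_imp_continuous_within)
  then have "continuous_on (X \<inter> cball x R) \<phi>"
    unfolding \<phi>_def bregman_def
    by (intro continuous_intros) (auto elim: continuous_on_subset)
  moreover have "compact (X \<inter> cball x R)"
    using \<open>closed X\<close> by (simp add: closed_Int_compact)
  moreover have "x \<in> X \<inter> cball x R"
    using \<open>x \<in> X\<close> \<open>0 \<le> R\<close> by simp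
  ultimately obtain p where p: "p \<in> X" "\<And>w. w \<in> X \<inter> cball x R \<Longrightarrow> \<phi> p \<le> \<phi> w"
    using continuous_attains_inf[of "X \<inter> cball x R" \<phi>] by blast
  have "\<phi> p \<le> \<phi> w" if "w \<in> X" for w
  proof (cases "dist x w \<le> R")
    case False
    then have "\<phi> x \<le> \<phi> w"
      by (intro far) simp
    moreover have "\<phi> p \<le> \<phi> x"
      using \<open>x \<in> X \<inter> cball x R\<close> by (rule p)
    ultimately show ?thesis
      by simp
  qed (use that p in simp)
  then have "is_arg_min \<phi> (\<lambda>w. w \<in> X) p"
    using p(1) by (simp add: is_arg_min_linorder)
  then have "is_arg_min \<phi> (\<lambda>w. w \<in> X) z"
    unfolding z_def bregman_prox_def arg_min_on_def arg_min_def \<phi>_def[symmetric]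
    by (rule someI)
  then show "z \<in> X" and "\<And>w. w \<in> X \<Longrightarrow>
      f z + 1 / lam * bregman h z x \<le> f w + 1 / lam * bregman h w x"
    by (auto simp: is_arg_min_linorder \<phi>_def)
qed

text \<open>The two-sided estimate of \<open>\<langle>v, x - z\<rangle>\<close>. The conclusion is about each single subgradient,
  so that the infimum in \<open>r_stat\<close> inherits the bound.\<close>

lemma infnorm_subgradient_ge_r2:
  fixes X :: "(real ^ 'd) set"
  assumes "closed X" and "convex X" and "x \<in> X"
    and f: "\<And>w. f differentiable (at w)" and h: "\<And>w. h differentiable (at w)"
    and strong: "strongly_convex_l1 h"
    and weak: "relatively_weakly_convex \<rho> h f"
    and "0 < lam" and curvature: "\<rho> < 1 / lam"
    and v: "v \<in> subdiff_constrained f X x"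
  shows "(1 - lam * \<rho>) * r2 X h lam f x \<le> infnorm v"
proof -
  define z where "z = bregman_prox X h lam f x"
  define S where "S = bregman h x z + bregman h z x"
  note z = bregman_prox_minimizes[OF \<open>closed X\<close> \<open>x \<in> X\<close> f h strong weak curvature,
      folded z_def]
  have S_inner: "S = (grad h x - grad h z) \<bullet> (x - z)"
    unfolding S_def by (rule bregman_symmetrized)
  have S_l1: "(l1norm (x - z))\<^sup>2 \<le> S"
    unfolding S_def using strong by (rule l1norm_square_le_bregman_symmetrized)
  obtain n where n: "v = grad f x + n" "n \<bullet> (z - x) \<le> 0"
    using v z(1) by (auto simp: subdiff_constrained_def normal_cone_def)

  have "0 \<le> (grad f z + (1 / lam) *\<^sub>R (grad h z - grad h x)) \<bullet> (x - z)"
    using \<open>convex X\<close> z(1) \<open>x \<in> X\<close> z(2) GDERIV_prox_objective[OF GDERIV_grad[OF f] GDERIV_grad[OF h]]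
    by (rule minimizer_gradient_inner_nonneg)
  then have optimal: "S / lam \<le> grad f z \<bullet> (x - z)"
    by (simp add: S_inner inner_add_left inner_diff_left diff_divide_distrib)
  have "0 \<le> (grad f x + \<rho> *\<^sub>R grad h x - (grad f z + \<rho> *\<^sub>R grad h z)) \<bullet> (x - z)"
    using weak[unfolded relatively_weakly_convex_def]
      GDERIV_weakly_convex_sum[OF GDERIV_grad[OF f] GDERIV_grad[OF h]]
      GDERIV_weakly_convex_sum[OF GDERIV_grad[OF f] GDERIV_grad[OF h]]
    by (rule convex_on_gradient_monotone)
  then have monotone: "- (\<rho> * S) \<le> (grad f x - grad f z) \<bullet> (x - z)"
    by (simp add: S_inner inner_add_left inner_diff_left algebra_simps)
  have "0 \<le> n \<bullet> (x - z)"
    using n(2) by (simp add: inner_diff_right)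
  with optimal monotone have "S / lam - \<rho> * S \<le> v \<bullet> (x - z)"
    by (simp add: n(1) inner_add_left inner_diff_left)
  also have "\<dots> \<le> infnorm v * l1norm (x - z)"
    by (rule inner_le_infnorm_l1norm)
  also have "\<dots> \<le> infnorm v * sqrt S"
    using S_l1 by (intro mult_left_mono real_le_rsqrt infnorm_pos_le)
  finally have pairing: "(1 / lam - \<rho>) * S \<le> infnorm v * sqrt S"
    by (simp add: algebra_simps)

  have "0 \<le> S"
    using S_l1 by (rule order_trans[OF zero_le_power2])
  have "(1 / lam - \<rho>) * sqrt S \<le> infnorm v"
  proof (cases "S = 0")
    case True
    then show ?thesis
      by (simp add: infnorm_pos_le)
  next
    case False
    with \<open>0 \<le> S\<close> have "0 < sqrt S"
      by simp
    moreover have "((1 / lam - \<rho>) * sqrt S) * sqrt S \<le> infnorm v * sqrt S"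
      using pairing \<open>0 \<le> S\<close> by (simp add: mult.assoc)
    ultimately show ?thesis
      by (simp only: mult_le_cancel_right_pos)
  qed
  moreover have "(1 - lam * \<rho>) * r2 X h lam f x = (1 / lam - \<rho>) * sqrt S"
    using \<open>0 < lam\<close> by (simp add: r2_def S_def z_def field_simps)
  ultimately show ?thesis
    by simp
qed

theorem lemma1:
  fixes X :: "(real ^ 'd) set"
    and h f :: "real ^ 'd \<Rightarrow> real"
    and \<rho> lam :: real
    and x :: "real ^ 'd"
  assumes "X \<noteq> {}" and "closed X" and "convex X"
    and "continuously_differentiable h"
    and "strongly_convex_l1 h"
    and "continuously_differentiable f"
    and "\<rho> > 0"
    and "relatively_weakly_convex \<rho> h f"
    and "lam \<in> {0<..<inverse \<rho>}"
    and "x \<in> X"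
  shows "r_stat f X x \<ge> (1 - lam * \<rho>) * r2 X h lam f x"
proof -
  have diff: "f differentiable (at w)" "h differentiable (at w)" for w
    using assms(4,6) by (simp_all add: continuously_differentiable_def)
  have lam: "0 < lam" "\<rho> < 1 / lam"
    using assms(7,9) by (auto simp: field_simps)
  have "grad f x + 0 \<in> subdiff_constrained f X x"
    unfolding subdiff_constrained_def using \<open>x \<in> X\<close> by (force simp: normal_cone_def)
  then have "{infnorm v | v. v \<in> subdiff_constrained f X x} \<noteq> {}"
    by blast
  then show ?thesis
    unfolding r_stat_def
    using infnorm_subgradient_ge_r2[OF assms(2,3,10) diff assms(5,8) lam]
    by (intro cInf_greatest) auto
qed

end
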